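(* Let $N\geq 1$ and $C=\{1,\ldots,N\}$, and let $\mathcal{S}_N$ be the symmetric group of $C$. (1) For every column vector $v\in\mathbb{R}^N$, the set $StatSym(v):=\{\rho\in\mathcal{S}_N \mid v^\rho=v\}$ of all state symmetries of $v$ is a group with respect to composition. (2) For every real $N\times N$ matrix $M$, the set $StatSym(M):=\{\rho\in\mathcal{S}_N\mid M^\rho=M\}$ of all state symmetries of $M$ is a group with respect to composition.
   Context: For a permutation $\rho$ of $C=\{1,\ldots,N\}$, a column vector $v=(v_i)\in\mathbb{R}^N$ and a real $N\times N$ matrix $M=(m_{ij})$, the reordered vector is $v^\rho:=(v_{\rho(i)})_i$ and the reordered matrix is $M^\rho:=(m_{\rho(i)\,\rho(j)})_{i,j}$. The permutation $\rho$ is a state symmetry of $v$ (resp. $M$) if $v^\rho=v$ (resp. $M^\rho=M$). *)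

theory Defs
  imports "HOL-Algebra.Sym_Groups" "HOL-Library.FuncSet" Complex_Main
begin

text \<open>
  A real vector of dimension \<open>N\<close> is a function from \<open>{1..N}\<close> to the reals, and a real \<open>N\<close> by \<open>N\<close>
  matrix is a function from \<open>{1..N} \<times> {1..N}\<close> to the reals. Functions are extensional, i.e. fixed to
  \<open>undefined\<close> off the index set, so that equality of functions is equality of all components.
  The index set is thus the one on which \<^const>\<open>sym_group\<close> acts.
\<close>

definition real_vectors :: "nat \<Rightarrow> (nat \<Rightarrow> real) set"
  where "real_vectors N = {1..N} \<rightarrow>\<^sub>E UNIV"

definition real_matrices :: "nat \<Rightarrow> (nat \<times> nat \<Rightarrow> real) set"
  where "real_matrices N = {1..N} \<times> {1..N} \<rightarrow>\<^sub>E UNIV"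

definition reorder_vec :: "nat \<Rightarrow> (nat \<Rightarrow> nat) \<Rightarrow> (nat \<Rightarrow> real) \<Rightarrow> nat \<Rightarrow> real"
  where "reorder_vec N \<rho> v = (\<lambda>i\<in>{1..N}. v (\<rho> i))"

definition reorder_mat :: "nat \<Rightarrow> (nat \<Rightarrow> nat) \<Rightarrow> (nat \<times> nat \<Rightarrow> real) \<Rightarrow> nat \<times> nat \<Rightarrow> real"
  where "reorder_mat N \<rho> M = (\<lambda>(i, j)\<in>{1..N} \<times> {1..N}. M (\<rho> i, \<rho> j))"

definition StatSym_vec :: "nat \<Rightarrow> (nat \<Rightarrow> real) \<Rightarrow> (nat \<Rightarrow> nat) set"
  where "StatSym_vec N v = {\<rho> \<in> carrier (sym_group N). reorder_vec N \<rho> v = v}"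

definition StatSym_mat :: "nat \<Rightarrow> (nat \<times> nat \<Rightarrow> real) \<Rightarrow> (nat \<Rightarrow> nat) set"
  where "StatSym_mat N M = {\<rho> \<in> carrier (sym_group N). reorder_mat N \<rho> M = M}"

end

theory Submission
  imports Defs
begin

text \<open>
  Permutations act on index positions: on \<open>{1..N}\<close> itself for vectors, and diagonally on
  \<open>{1..N} \<times> {1..N}\<close> for matrices. A vector or a matrix is a real function on the positions, and
  reordering is precomposition with the action, so a state symmetry is a permutation under which
  this function is invariant. The elements of an acting group that leave a given function on
  positions invariant always form a subgroup (\<open>subgroup_invariant_under_action\<close>), and both claims
  are instances of this.
\<close>

text \<open>
  Closure under products is two successive uses of invariance. For inverses, moving \<open>x\<close> by
  \<open>inv g\<close> gives a position that \<open>g\<close> sends back to \<open>x\<close>, so invariance under \<open>g\<close> at that position is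
  invariance under \<open>inv g\<close> at \<open>x\<close>.
\<close>

lemma (in group) subgroup_invariant_under_action:
  assumes closed: "\<And>g x. g \<in> carrier G \<Longrightarrow> x \<in> X \<Longrightarrow> act g x \<in> X"
    and one: "\<And>x. x \<in> X \<Longrightarrow> act \<one> x = x"
    and mult: "\<And>g h x. g \<in> carrier G \<Longrightarrow> h \<in> carrier G \<Longrightarrow> x \<in> X \<Longrightarrow>
      act (g \<otimes> h) x = act g (act h x)"
  shows "subgroup {g \<in> carrier G. \<forall>x\<in>X. f (act g x) = f x} G"
proof (rule subgroupI)
  show "{g \<in> carrier G. \<forall>x\<in>X. f (act g x) = f x} \<noteq> {}"
    using one by force
next
  fix g
  assume g: "g \<in> {g \<in> carrier G. \<forall>x\<in>X. f (act g x) = f x}"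
  have "f (act (inv g) x) = f x" if x: "x \<in> X" for x
  proof -
    have "f (act (inv g) x) = f (act g (act (inv g) x))"
      using g x by (simp add: closed)
    also have "act g (act (inv g) x) = x"
      using g x mult[of g "inv g" x] by (simp add: one)
    finally show ?thesis .
  qed
  then show "inv g \<in> {g \<in> carrier G. \<forall>x\<in>X. f (act g x) = f x}"
    using g by simp
next
  fix g h
  assume "g \<in> {g \<in> carrier G. \<forall>x\<in>X. f (act g x) = f x}"
    and "h \<in> {g \<in> carrier G. \<forall>x\<in>X. f (act g x) = f x}"
  then show "g \<otimes> h \<in> {g \<in> carrier G. \<forall>x\<in>X. f (act g x) = f x}"
    by (simp add: mult closed)
qed auto

lemma sym_group_apply_in_range:
  assumes "\<rho> \<in> carrier (sym_group N)" and "i \<in> {1..N}"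
  shows "\<rho> i \<in> {1..N}"
  using assms permutes_in_image unfolding sym_group_def by fastforce

text \<open>
  Extensionality of \<open>v\<close> is what turns the equation between functions on all of \<open>nat\<close> into
  componentwise invariance: off the index set both sides are \<open>undefined\<close>.
\<close>

lemma StatSym_vec_eq_invariant:
  assumes "v \<in> real_vectors N"
  shows "StatSym_vec N v = {\<rho> \<in> carrier (sym_group N). \<forall>i\<in>{1..N}. v (\<rho> i) = v i}"
proof -
  have "reorder_vec N \<rho> v = v \<longleftrightarrow> (\<forall>i\<in>{1..N}. v (\<rho> i) = v i)" for \<rho>
  proof -
    have "v \<in> extensional {1..N}"
      using assms by (simp add: real_vectors_def PiE_def)
    then show ?thesis
      unfolding reorder_vec_def by (auto simp: fun_eq_iff extensional_def)
  qed
  then show ?thesis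
    by (simp add: StatSym_vec_def)
qed

lemma StatSym_mat_eq_invariant:
  assumes "M \<in> real_matrices N"
  shows "StatSym_mat N M =
    {\<rho> \<in> carrier (sym_group N). \<forall>x\<in>{1..N} \<times> {1..N}. M (map_prod \<rho> \<rho> x) = M x}"
proof -
  have "reorder_mat N \<rho> M = M \<longleftrightarrow> (\<forall>x\<in>{1..N} \<times> {1..N}. M (map_prod \<rho> \<rho> x) = M x)" for \<rho>
  proof -
    have "M \<in> extensional ({1..N} \<times> {1..N})"
      using assms by (simp add: real_matrices_def PiE_def)
    then show ?thesis
      unfolding reorder_mat_def by (auto simp: fun_eq_iff extensional_def)
  qed
  then show ?thesis
    by (simp add: StatSym_mat_def)
qed

lemma subgroup_StatSym_vec:
  assumes "v \<in> real_vectors N"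
  shows "subgroup (StatSym_vec N v) (sym_group N)"
  unfolding StatSym_vec_eq_invariant[OF assms]
proof (rule group.subgroup_invariant_under_action[OF sym_group_is_group])
  fix \<rho> i
  assume "\<rho> \<in> carrier (sym_group N)" and "i \<in> {1..N}"
  then show "\<rho> i \<in> {1..N}"
    by (rule sym_group_apply_in_range)
qed (simp_all add: sym_group_def)

lemma subgroup_StatSym_mat:
  assumes "M \<in> real_matrices N"
  shows "subgroup (StatSym_mat N M) (sym_group N)"
  unfolding StatSym_mat_eq_invariant[OF assms]
proof (rule group.subgroup_invariant_under_action[OF sym_group_is_group])
  fix \<rho> x
  assume "\<rho> \<in> carrier (sym_group N)" and "x \<in> {1..N} \<times> {1..N}"
  then show "map_prod \<rho> \<rho> x \<in> {1..N} \<times> {1..N}"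
    using sym_group_apply_in_range by fastforce
qed (auto simp: sym_group_def)

theorem theorem1:
  fixes N :: nat
  assumes "N \<ge> 1"
  shows "(\<forall>v \<in> real_vectors N. group (sym_group N \<lparr>carrier := StatSym_vec N v\<rparr>)) \<and>
         (\<forall>M \<in> real_matrices N. group (sym_group N \<lparr>carrier := StatSym_mat N M\<rparr>))"
  using subgroup_StatSym_vec subgroup_StatSym_mat subgroup.subgroup_is_group sym_group_is_group
  by blast

end
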